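(* The only asymmetric $3$-quasi-transitive CKI-digraph is $\overrightarrow{C}_3$. Moreover, an asymmetric digraph $D$ that is arc-locally in-semicomplete, or arc-locally out-semicomplete, or $3$-anti-quasi-transitive and $TT_3$-free, is a CKI-digraph if and only if $D$ is a directed cycle of odd length.
   Context: Digraphs are finite, without loops or parallel arcs. $D$ is asymmetric if there are no two vertices $u,v$ with both $uv,vu\in A(D)$. A kernel is a set $S$ of vertices that is independent (no arc between two vertices of $S$) and absorbent (every vertex outside $S$ has an arc into $S$). $D$ is a CKI-digraph if $D$ has no kernel but every proper induced subdigraph has a kernel. Consider paths $uvwx$ on four distinct vertices (not necessarily directed). $D$ is arc-locally in-semicomplete if for every such path with arcs $uv,wv,xw$ the vertices $u,x$ are adjacent; arc-locally out-semicomplete if for every such path with arcs $vu,wv,wx$ the vertices $u,x$ are adjacent; $3$-quasi-transitive if for every directed path $uvwx$ (arcs $uv,vw,wx$) the vertices $u,x$ are adjacent; $3$-anti-quasi-transitive if for every anti-directed path $uvwx$ (a path with no directed subpath of length $2$) the vertices $u,x$ are adjacent. $TT_3$ is the transitive tournament on $3$ vertices, and $TT_3$-free means no induced subdigraph is isomorphic to $TT_3$. $\overrightarrow{C}_3$ is the directed $3$-cycle. *)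

theory Defs
  imports "Graph_Theory.Digraph_Isomorphism"
begin

definition asymmetric :: "('a, 'b) pre_digraph \<Rightarrow> bool" where
  "asymmetric D \<longleftrightarrow> asym (arcs_ends D)"

definition adjacent :: "('a, 'b) pre_digraph \<Rightarrow> 'a \<Rightarrow> 'a \<Rightarrow> bool" where
  "adjacent D u v \<longleftrightarrow> u \<rightarrow>\<^bsub>D\<^esub> v \<or> v \<rightarrow>\<^bsub>D\<^esub> u"

definition independent_set :: "('a, 'b) pre_digraph \<Rightarrow> 'a set \<Rightarrow> bool" where
  "independent_set D S \<longleftrightarrow> S \<subseteq> verts D \<and> (\<forall>u\<in>S. \<forall>v\<in>S. \<not> u \<rightarrow>\<^bsub>D\<^esub> v)"

definition absorbent_set :: "('a, 'b) pre_digraph \<Rightarrow> 'a set \<Rightarrow> bool" where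
  "absorbent_set D S \<longleftrightarrow> S \<subseteq> verts D \<and> (\<forall>u\<in>verts D - S. \<exists>v\<in>S. u \<rightarrow>\<^bsub>D\<^esub> v)"

definition kernel_of :: "('a, 'b) pre_digraph \<Rightarrow> 'a set \<Rightarrow> bool" where
  "kernel_of D S \<longleftrightarrow> independent_set D S \<and> absorbent_set D S"

definition has_kernel :: "('a, 'b) pre_digraph \<Rightarrow> bool" where
  "has_kernel D \<longleftrightarrow> (\<exists>S. kernel_of D S)"

text \<open>The null subdigraph is among the proper induced subdigraphs; the empty set is a kernel
  of it, so it does not affect the definition.\<close>

definition CKI_digraph :: "('a, 'b) pre_digraph \<Rightarrow> bool" where
  "CKI_digraph D \<longleftrightarrow>
     \<not> has_kernel D \<and> (\<forall>H. induced_subgraph H D \<and> verts H \<subset> verts D \<longrightarrow> has_kernel H)"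

definition arc_locally_in_semicomplete :: "('a, 'b) pre_digraph \<Rightarrow> bool" where
  "arc_locally_in_semicomplete D \<longleftrightarrow>
     (\<forall>u v w x. distinct [u, v, w, x] \<and> u \<rightarrow>\<^bsub>D\<^esub> v \<and> w \<rightarrow>\<^bsub>D\<^esub> v \<and> x \<rightarrow>\<^bsub>D\<^esub> w \<longrightarrow> adjacent D u x)"

definition arc_locally_out_semicomplete :: "('a, 'b) pre_digraph \<Rightarrow> bool" where
  "arc_locally_out_semicomplete D \<longleftrightarrow>
     (\<forall>u v w x. distinct [u, v, w, x] \<and> v \<rightarrow>\<^bsub>D\<^esub> u \<and> w \<rightarrow>\<^bsub>D\<^esub> v \<and> w \<rightarrow>\<^bsub>D\<^esub> x \<longrightarrow> adjacent D u x)"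

definition three_quasi_transitive :: "('a, 'b) pre_digraph \<Rightarrow> bool" where
  "three_quasi_transitive D \<longleftrightarrow>
     (\<forall>u v w x. distinct [u, v, w, x] \<and> u \<rightarrow>\<^bsub>D\<^esub> v \<and> v \<rightarrow>\<^bsub>D\<^esub> w \<and> w \<rightarrow>\<^bsub>D\<^esub> x \<longrightarrow> adjacent D u x)"

text \<open>A path on four vertices has no directed subpath of length 2 iff its arcs alternate in
  direction, which leaves the two orientations below.\<close>

definition three_anti_quasi_transitive :: "('a, 'b) pre_digraph \<Rightarrow> bool" where
  "three_anti_quasi_transitive D \<longleftrightarrow>
     (\<forall>u v w x. distinct [u, v, w, x] \<and>
        (u \<rightarrow>\<^bsub>D\<^esub> v \<and> w \<rightarrow>\<^bsub>D\<^esub> v \<and> w \<rightarrow>\<^bsub>D\<^esub> x \<or> v \<rightarrow>\<^bsub>D\<^esub> u \<and> v \<rightarrow>\<^bsub>D\<^esub> w \<and> x \<rightarrow>\<^bsub>D\<^esub> w)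
        \<longrightarrow> adjacent D u x)"

definition TT3 :: "nat pair_pre_digraph" where
  "TT3 = \<lparr> pverts = {0, 1, 2}, parcs = {(0, 1), (1, 2), (0, 2)} \<rparr>"

definition TT3_free :: "('a, 'b) pre_digraph \<Rightarrow> bool" where
  "TT3_free D \<longleftrightarrow> \<not> (\<exists>H. induced_subgraph H D \<and> digraph_iso H (with_proj TT3))"

definition directed_cycle :: "nat \<Rightarrow> nat pair_pre_digraph" where
  "directed_cycle n = \<lparr> pverts = {..<n}, parcs = {(i, Suc i mod n) | i. i < n} \<rparr>"

text \<open>The bound excludes the one-vertex loop \<^term>\<open>directed_cycle 1\<close>, which is not a loopless
  digraph.\<close>

definition is_directed_cycle :: "('a, 'b) pre_digraph \<Rightarrow> nat \<Rightarrow> bool" where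
  "is_directed_cycle D n \<longleftrightarrow> 2 \<le> n \<and> digraph_iso D (with_proj (directed_cycle n))"

end

theory Submission
  imports Defs
begin

text \<open>A digraph without a kernel whose proper induced subdigraphs all have one is strong, and it
  has a closed walk of odd length: otherwise the vertices at even distance from a root form a kernel.
  Take a shortest odd closed walk \<open>g 0, \<dots>, g n = g 0\<close>. By minimality it is a cycle, and
  a chord from \<open>g i\<close> to \<open>g (i + m)\<close> has \<open>m\<close> even, since the chord and the rest of the cycle
  form a closed walk of length \<open>n - m + 1\<close>. In each of the classes a chord of length \<open>m + 2\<close>
  forces one of length \<open>m\<close>, hence chords of length 2, and these give a shorter odd closed walk
  or a transitive triangle. So the cycle is induced; it has no kernel, so it is
  everything.\<close>

section \<open>Kernels of relations\<close>

text \<open>The relation stays fixed while \<open>W\<close> varies, so that an induced subdigraph is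
  just a subset of the vertices.\<close>

definition kernel_on :: "('a \<times> 'a) set \<Rightarrow> 'a set \<Rightarrow> 'a set \<Rightarrow> bool" where
  "kernel_on R W S \<longleftrightarrow>
     S \<subseteq> W \<and> (\<forall>u\<in>S. \<forall>v\<in>S. (u, v) \<notin> R) \<and> (\<forall>u\<in>W - S. \<exists>v\<in>S. (u, v) \<in> R)"

definition kernel_critical :: "('a \<times> 'a) set \<Rightarrow> 'a set \<Rightarrow> bool" where
  "kernel_critical R V \<longleftrightarrow>
     (\<nexists>S. kernel_on R V S) \<and> (\<forall>W. W \<subset> V \<longrightarrow> (\<exists>S. kernel_on R W S))"

text \<open>For finite \<open>W\<close> the hypothesis says that \<open>R\<close> is acyclic on
  \<open>W\<close>. Choose greedily: take a sink, delete it together with its in-neighbours, which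
  it absorbs, and add a kernel of the rest.\<close>

lemma kernel_on_if_sinks:
  assumes "finite W"
    and "\<And>U. U \<subseteq> W \<Longrightarrow> U \<noteq> {} \<Longrightarrow> \<exists>s\<in>U. \<forall>u\<in>U. (s, u) \<notin> R"
  shows "\<exists>S. kernel_on R W S"
  using assms
proof (induction W rule: finite_psubset_induct)
  case (psubset W)
  show ?case
  proof (cases "W = {}")
    case True
    then show ?thesis by (auto simp: kernel_on_def)
  next
    case False
    then obtain s where s: "s \<in> W" "\<forall>u\<in>W. (s, u) \<notin> R"
      using psubset.prems[of W] by blast
    let ?U = "{u \<in> W. u \<noteq> s \<and> (u, s) \<notin> R}"
    have "?U \<subset> W" using s by blast
    moreover from this have "\<exists>t\<in>X. \<forall>u\<in>X. (t, u) \<notin> R" if "X \<subseteq> ?U" "X \<noteq> {}" for X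
      using psubset.prems[of X] that by blast
    ultimately obtain S where S: "kernel_on R ?U S" using psubset.IH[of ?U] by blast
    have "kernel_on R W (insert s S)"
      using S s unfolding kernel_on_def by blast
    then show ?thesis ..
  qed
qed

text \<open>The set \<open>C\<close> of vertices reachable from \<open>x\<close> has no outgoing
  arcs. If it is proper, a kernel \<open>S\<close> of \<open>C\<close> and a kernel of the vertices
  outside \<open>C\<close> that \<open>S\<close> does not absorb combine to a kernel of
  \<open>V\<close>.\<close>

lemma kernel_critical_strong:
  assumes crit: "kernel_critical R V" and R: "R \<subseteq> V \<times> V" and x: "x \<in> V" and y: "y \<in> V"
  shows "(x, y) \<in> R\<^sup>*"
proof (rule ccontr)
  assume no: "(x, y) \<notin> R\<^sup>*"
  define C where "C = {z \<in> V. (x, z) \<in> R\<^sup>*}"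
  have closed: "b \<in> C" if "a \<in> C" "(a, b) \<in> R" for a b
    using that R unfolding C_def by (auto intro: rtrancl_into_rtrancl)
  have xC: "x \<in> C" using x by (simp add: C_def)
  have "C \<subset> V" using no y by (auto simp: C_def)
  then obtain S where S: "kernel_on R C S" using crit unfolding kernel_critical_def by blast
  define U where "U = {u \<in> V - C. \<forall>s\<in>S. (u, s) \<notin> R}"
  have "U \<subset> V" using xC x by (auto simp: U_def)
  then obtain T where T: "kernel_on R U T" using crit unfolding kernel_critical_def by blast
  have SC: "S \<subseteq> C" and TU: "T \<subseteq> U" using S T by (auto simp: kernel_on_def)
  have "kernel_on R V (S \<union> T)"
    unfolding kernel_on_def
  proof (intro conjI ballI)
    show "S \<union> T \<subseteq> V" using SC TU by (auto simp: C_def U_def)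
  next
    fix u v assume "u \<in> S \<union> T" "v \<in> S \<union> T"
    then consider "u \<in> S" "v \<in> S" | "u \<in> S" "v \<in> T" | "u \<in> T" "v \<in> S" | "u \<in> T" "v \<in> T" by blast
    then show "(u, v) \<notin> R"
    proof cases
      case 2
      then show ?thesis using closed SC TU unfolding U_def by blast
    next
      case 3
      then show ?thesis using TU unfolding U_def by blast
    qed (use S T in \<open>auto simp: kernel_on_def\<close>)
  next
    fix u assume "u \<in> V - (S \<union> T)"
    then consider "u \<in> C - S" | "u \<in> V - C - U" | "u \<in> U - T" using U_def by blast
    then show "\<exists>v\<in>S \<union> T. (u, v) \<in> R"
      by cases (use S T in \<open>auto simp: kernel_on_def U_def\<close>)
  qed
  then show False using crit unfolding kernel_critical_def by blast
qed

lemma kernel_critical_odd_closed_walk: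
  assumes crit: "kernel_critical R V" and R: "R \<subseteq> V \<times> V"
  shows "\<exists>x k. odd k \<and> (x, x) \<in> R ^^ k"
proof (rule ccontr)
  assume none: "\<not> ?thesis"
  have "V \<noteq> {}" using crit unfolding kernel_critical_def kernel_on_def by blast
  then obtain r where r: "r \<in> V" by blast
  define S where "S = {x \<in> V. \<exists>k. even k \<and> (r, x) \<in> R ^^ k}"
  have rS: "r \<in> S" using r unfolding S_def by (auto intro!: exI[of _ 0])
  have "kernel_on R V S"
    unfolding kernel_on_def
  proof (intro conjI ballI)
    show "S \<subseteq> V" by (auto simp: S_def)
  next
    fix u v assume "u \<in> S" "v \<in> S"
    then obtain k l where k: "even k" "(r, u) \<in> R ^^ k" and l: "even l" "(r, v) \<in> R ^^ l"
      and v: "v \<in> V" unfolding S_def by blast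
    obtain m where m: "(v, r) \<in> R ^^ m"
      using kernel_critical_strong[OF crit R v r] rtrancl_imp_relpow by metis
    show "(u, v) \<notin> R"
    proof
      assume "(u, v) \<in> R"
      then have "(r, v) \<in> R ^^ Suc k" using k by auto
      \<comment> \<open>The lengths of these two closed walks differ in parity, as \<open>k\<close>
        and \<open>l\<close> are even, so one of them is odd.\<close>
      then have "(r, r) \<in> R ^^ (Suc k + m)" "(r, r) \<in> R ^^ (l + m)"
        using l m by (blast intro: relpow_trans)+
      then show False using none k l by (metis even_Suc even_add)
    qed
  next
    fix u assume u: "u \<in> V - S"
    \<comment> \<open>As \<open>u \<noteq> r\<close>, the walk from \<open>u\<close> back to
      \<open>r\<close> has a first arc.\<close>
    then have "(u, r) \<in> R\<^sup>*" "u \<noteq> r" using kernel_critical_strong[OF crit R _ r] rS by auto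
    then obtain w where w: "(u, w) \<in> R" by (meson converse_rtranclE)
    obtain k where k: "(r, u) \<in> R ^^ k"
      using kernel_critical_strong[OF crit R r] u rtrancl_imp_relpow by (metis DiffD1)
    then have "odd k" using u S_def by blast
    moreover have "(r, w) \<in> R ^^ Suc k" using k w by auto
    ultimately have "w \<in> S" using w R unfolding S_def by (metis (mono_tags, lifting) CollectI SigmaD2 even_Suc subsetD)
    then show "\<exists>v\<in>S. (u, v) \<in> R" using w by blast
  qed
  then show False using crit unfolding kernel_critical_def by blast
qed

section \<open>Odd cycles are kernel critical\<close>

text \<open>The equivalence makes the cycle induced: \<open>W\<close> carries no arcs other than
  those of the cycle.\<close>

definition cycle_on :: "('a \<times> 'a) set \<Rightarrow> 'a set \<Rightarrow> nat \<Rightarrow> (nat \<Rightarrow> 'a) \<Rightarrow> bool" where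
  "cycle_on R W n v \<longleftrightarrow>
     bij_betw v {..<n} W \<and> (\<forall>i<n. \<forall>j<n. (v i, v j) \<in> R \<longleftrightarrow> j = Suc i mod n)"

text \<open>Each vertex has a single out-neighbour on the cycle, so exactly one of two consecutive
  vertices lies in a kernel. An odd cycle cannot alternate in this way.\<close>

lemma cycle_on_no_kernel:
  assumes cyc: "cycle_on R W n v" and n: "odd n"
  shows "\<nexists>S. kernel_on R W S"
proof
  assume "\<exists>S. kernel_on R W S"
  then obtain S where S: "kernel_on R W S" ..
  have n0: "0 < n" using n by (cases n) auto
  have W: "W = v ` {..<n}" using cyc by (simp add: cycle_on_def bij_betw_def)
  have step: "v (Suc i mod n) \<in> S \<longleftrightarrow> v (i mod n) \<notin> S" for i
  proof -
    have vW: "v (i mod n) \<in> W" using n0 W by simp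
    have arc: "(v (i mod n), v j) \<in> R \<longleftrightarrow> j = Suc i mod n" if "j < n" for j
      using cyc n0 that unfolding cycle_on_def by (simp add: mod_Suc_eq)
    have "v (Suc i mod n) \<in> S" if notin: "v (i mod n) \<notin> S"
    proof -
      obtain s where s: "s \<in> S" "(v (i mod n), s) \<in> R"
        using S notin vW unfolding kernel_on_def by blast
      then obtain j where "j < n" "s = v j" using S W unfolding kernel_on_def by blast
      then show ?thesis using s arc by blast
    qed
    moreover have "(v (i mod n), v (Suc i mod n)) \<in> R" using arc n0 by simp
    ultimately show ?thesis using S unfolding kernel_on_def by blast
  qed
  have "v (k mod n) \<in> S \<longleftrightarrow> (v 0 \<in> S \<longleftrightarrow> even k)" for k
    by (induction k) (auto simp: step)
  from this[of n] show False using n by simp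
qed

text \<open>A nonempty set without a sink contains the unique out-neighbour of each of its vertices,
  hence the whole cycle. So every nonempty part of \<open>W\<close> has a sink.\<close>

lemma cycle_on_proper_subset_kernel:
  assumes cyc: "cycle_on R V n v" and W: "W \<subset> V"
  shows "\<exists>S. kernel_on R W S"
proof (rule kernel_on_if_sinks)
  have V: "V = v ` {..<n}" using cyc by (simp add: cycle_on_def bij_betw_def)
  show "finite W" using W V finite_subset by blast
  fix U assume U: "U \<subseteq> W" "U \<noteq> {}"
  show "\<exists>s\<in>U. \<forall>u\<in>U. (s, u) \<notin> R"
  proof (rule ccontr)
    assume no: "\<not> ?thesis"
    obtain a where a: "a < n" "v a \<in> U" using U W V by blast
    have "v ((a + k) mod n) \<in> U" for k
    proof (induction k)
      case (Suc k)
      then obtain u where u: "u \<in> U" "(v ((a + k) mod n), u) \<in> R" using no by blast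
      then obtain j where "j < n" "u = v j" using U W V by blast
      then show ?case using u cyc a unfolding cycle_on_def by (auto simp: mod_Suc_eq)
    qed (use a in auto)
    \<comment> \<open>Since \<open>a < n\<close>, the number \<open>b + n\<close> has the form
      \<open>a + k\<close>.\<close>
    then have "v b \<in> U" if "b < n" for b
      using that a by (metis add.commute le_add_diff_inverse2 less_imp_le_nat mod_add_self2 mod_less trans_le_add2)
    then show False using U W V by blast
  qed
qed

lemma cycle_on_kernel_critical:
  assumes "cycle_on R V n v" "odd n"
  shows "kernel_critical R V"
  using cycle_on_no_kernel[OF assms] cycle_on_proper_subset_kernel[OF assms(1)]
  unfolding kernel_critical_def by blast

section \<open>Shortest odd closed walks\<close>

text \<open>The walk is extended periodically, so that indices need no reduction modulo \<open>n\<close>.\<close>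

locale shortest_odd_closed_walk =
  fixes R :: "('a \<times> 'a) set" and n :: nat and g :: "nat \<Rightarrow> 'a"
  assumes odd_n: "odd n"
    and asym_R: "asym R"
    and step: "(g i, g (Suc i)) \<in> R"
    and period: "g (i + n) = g i"
    and minimal: "odd k \<Longrightarrow> (x, x) \<in> R ^^ k \<Longrightarrow> n \<le> k"
begin

section \<open>Distinctness of the walk's vertices and parity of its chords\<close>

lemma walk: "(g i, g (i + k)) \<in> R ^^ k"
proof (induction k)
  case (Suc k)
  then show ?case using step[of "i + k"] by auto
qed simp

lemma antisym_arc: "(x, y) \<in> R \<Longrightarrow> (y, x) \<notin> R"
  using asym_R by (auto dest: asymD)

text \<open>A repeated vertex splits one period into two shorter closed walks. Their lengths add up
  to the odd \<open>n\<close>, so one of them is odd, against minimality.\<close>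

lemma g_neq:
  assumes "i < j" "j < i + n"
  shows "g i \<noteq> g j"
proof
  assume eq: "g i = g j"
  have "(g i, g i) \<in> R ^^ (j - i)" using walk[of i "j - i"] assms eq by simp
  moreover have "(g i, g i) \<in> R ^^ (n - (j - i))"
    using walk[of j "n - (j - i)"] assms eq period[of i] by (simp add: add.commute)
  moreover have "odd ((j - i) + (n - (j - i)))" using odd_n assms by simp
  then have "odd (j - i) \<or> odd (n - (j - i))" unfolding odd_add by blast
  ultimately show False using minimal[of "j - i"] minimal[of "n - (j - i)"] assms by fastforce
qed

lemma g_eq_iff: "i < j + n \<Longrightarrow> j < i + n \<Longrightarrow> g i = g j \<longleftrightarrow> i = j"
  using g_neq[of i j] g_neq[of j i] by (metis nat_neq_iff)

text \<open>The chord shortcuts \<open>m\<close> arcs, leaving a closed walk of length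
  \<open>n - m + 1 < n\<close>, which must be even. Span \<open>n - 1\<close> would reverse an arc
  of the cycle, so asymmetry and parity leave a gap of at least 3.\<close>

lemma chord:
  assumes arc: "(g i, g (i + m)) \<in> R" and m: "1 < m" "m < n"
  shows "even m" "m + 3 \<le> n"
proof -
  have "(g (i + m), g i) \<in> R ^^ (n - m)"
    using walk[of "i + m" "n - m"] m period[of i] by simp
  then have "(g i, g i) \<in> R ^^ Suc (n - m)" using arc by (meson relpow_Suc_I2)
  then have "\<not> odd (Suc (n - m))" using minimal[of "Suc (n - m)"] m by fastforce
  then show even: "even m" using odd_n m by simp
  have "m + 1 \<noteq> n"
    using step[of "i + m"] period[of i] antisym_arc[OF arc] by (metis add.assoc add_Suc_right Suc_eq_plus1)
  then show "m + 3 \<le> n" using m even odd_n by presburger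
qed

text \<open>The reverse arc would be a chord from \<open>g (i + m)\<close> to
  \<open>g (i + n)\<close> of odd span \<open>n - m\<close>; the bound on \<open>m\<close> makes
  that span exceed 1.\<close>

lemma adjacent_even:
  assumes "(g i, g (i + m)) \<in> R \<or> (g (i + m), g i) \<in> R" "even m" "1 < m" "m + 1 < n"
  shows "(g i, g (i + m)) \<in> R"
proof (rule ccontr)
  assume "\<not> ?thesis"
  then have "(g (i + m), g (i + m + (n - m))) \<in> R" using assms period[of i] by simp
  then have "even (n - m)" using chord(1) assms by fastforce
  then show False using assms odd_n by simp
qed

lemma adjacent_odd:
  assumes "(g i, g (i + m)) \<in> R \<or> (g (i + m), g i) \<in> R" "odd m" "1 < m" "m < n"
  shows "(g (i + m), g i) \<in> R"
  using assms chord(1)[of i m] by blast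

text \<open>Two chords replace four arcs and give a closed walk of odd length
  \<open>n - 2\<close>.\<close>

lemma no_consecutive_short_chords:
  assumes "5 \<le> n" "(g i, g (i + 2)) \<in> R" "(g (i + 2), g (i + 4)) \<in> R"
  shows False
proof -
  have "(g (i + 4), g i) \<in> R ^^ (n - 4)" using walk[of "i + 4" "n - 4"] assms period[of i] by simp
  then have "(g i, g i) \<in> R ^^ Suc (Suc (n - 4))" using assms by (meson relpow_Suc_I2)
  moreover have "odd (Suc (Suc (n - 4)))" using odd_n assms by simp
  ultimately have "n \<le> Suc (Suc (n - 4))" using minimal by blast
  then show False using assms by simp
qed

section \<open>Descent to chords of span 2 in each class\<close>

text \<open>The induction shared by all classes; each supplies its own \<open>descent\<close>, where
  the shorter chord may start elsewhere. Spans of chords are even, so the descent ends at exactly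
  2.\<close>

lemma chord_descent:
  assumes descent: "\<And>i m. even m \<Longrightarrow> 2 \<le> m \<Longrightarrow> m + 5 \<le> n \<Longrightarrow> (g i, g (i + (m + 2))) \<in> R
      \<Longrightarrow> \<exists>j. (g j, g (j + m)) \<in> R"
    and arc: "(g i, g (i + m)) \<in> R" and m: "1 < m" "m < n"
  shows "5 \<le> n \<and> (\<exists>j. (g j, g (j + 2)) \<in> R)"
  using arc m
proof (induction m arbitrary: i rule: less_induct)
  case (less m)
  have m: "even m" "m + 3 \<le> n" using chord less.prems by blast+
  show ?case
  proof (cases "m = 2")
    case False
    define l where "l = m - 2"
    have l: "m = l + 2" "2 \<le> l" "even l"
      using m(1) less.prems(2) False unfolding l_def by presburger+
    have "(g i, g (i + (l + 2))) \<in> R" using less.prems(1) l(1) by simp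
    then obtain j where "(g j, g (j + l)) \<in> R" using descent[of l i] m(2) l by auto
    then show ?thesis using less.IH[of l j] l less.prems(3) by simp
  next
    case True
    then show ?thesis using less.prems(1) m(2) by auto
  qed
qed

text \<open>The head of a chord moves back two steps along the cycle, keeping the tail. Chords of
  span 2 then shift backward one step at a time, and two shifts produce consecutive ones.\<close>

lemma in_semicomplete_chordless:
  assumes adj: "\<And>u v w x. distinct [u, v, w, x] \<Longrightarrow> (u, v) \<in> R \<Longrightarrow> (w, v) \<in> R \<Longrightarrow> (x, w) \<in> R
      \<Longrightarrow> (u, x) \<in> R \<or> (x, u) \<in> R"
    and arc: "(g i, g (i + m)) \<in> R" and m: "1 < m" "m < n"
  shows False
proof -
  have descent: "\<exists>j. (g j, g (j + m)) \<in> R"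
    if "even m" "2 \<le> m" "m + 5 \<le> n" "(g i, g (i + (m + 2))) \<in> R" for i m
  proof -
    have "distinct [g i, g (i + (m + 2)), g (i + (m + 1)), g (i + m)]"
      using that by (simp add: g_eq_iff)
    then have "(g i, g (i + m)) \<in> R \<or> (g (i + m), g i) \<in> R"
      using adj[of "g i" "g (i + (m + 2))" "g (i + (m + 1))" "g (i + m)"] that
        step[of "i + m"] step[of "i + (m + 1)"] by simp
    then show ?thesis using adjacent_even[of i m] that by auto
  qed
  have "5 \<le> n \<and> (\<exists>j. (g j, g (j + 2)) \<in> R)"
    by (rule chord_descent[OF descent arc m])
  then obtain j where n: "5 \<le> n" and j: "(g j, g (j + 2)) \<in> R" by blast
  have backward: "(g i, g (i + 2)) \<in> R" if "(g (i + 1), g (i + 3)) \<in> R" for i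
  proof -
    have "distinct [g (i + 2), g (i + 3), g (i + 1), g i]"
      using n by (simp add: g_eq_iff)
    then have "(g i, g (i + 2)) \<in> R \<or> (g (i + 2), g i) \<in> R"
      using adj[of "g (i + 2)" "g (i + 3)" "g (i + 1)" "g i"] that
        step[of i] step[of "i + 2"] by (auto simp add: numeral_eq_Suc)
    then show ?thesis using adjacent_even[of i 2] n by auto
  qed
  \<comment> \<open>\<open>h\<close> stands for \<open>j - 2\<close>, raised by one period so that
    the subtraction does not truncate.\<close>
  define h where "h = j + n - 2"
  have "h + 2 = j + n" "h + 4 = j + 2 + n" using n by (simp_all add: h_def)
  then have h2: "(g (h + 2), g (h + 4)) \<in> R" using j period by metis
  then have "(g (h + 1), g (h + 3)) \<in> R" using backward[of "h + 1"] by (simp add: numeral_eq_Suc)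
  then have "(g h, g (h + 2)) \<in> R" by (rule backward)
  then show False using no_consecutive_short_chords n h2 by blast
qed

text \<open>The argument under arc reversal: the tail of a chord moves forward two steps, and chords
  of span 2 shift forward.\<close>

lemma out_semicomplete_chordless:
  assumes adj: "\<And>u v w x. distinct [u, v, w, x] \<Longrightarrow> (v, u) \<in> R \<Longrightarrow> (w, v) \<in> R \<Longrightarrow> (w, x) \<in> R
      \<Longrightarrow> (u, x) \<in> R \<or> (x, u) \<in> R"
    and arc: "(g i, g (i + m)) \<in> R" and m: "1 < m" "m < n"
  shows False
proof -
  have descent: "\<exists>j. (g j, g (j + m)) \<in> R"
    if "even m" "2 \<le> m" "m + 5 \<le> n" "(g i, g (i + (m + 2))) \<in> R" for i m
  proof -
    have "distinct [g (i + 2), g (i + 1), g i, g (i + 2 + m)]"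
      using that by (simp add: g_eq_iff)
    then have "(g (i + 2), g (i + 2 + m)) \<in> R \<or> (g (i + 2 + m), g (i + 2)) \<in> R"
      using adj[of "g (i + 2)" "g (i + 1)" "g i" "g (i + 2 + m)"] that
        step[of i] step[of "i + 1"] by (simp add: numeral_eq_Suc)
    then show ?thesis using adjacent_even[of "i + 2" m] that by (intro exI[of _ "i + 2"]) auto
  qed
  have "5 \<le> n \<and> (\<exists>j. (g j, g (j + 2)) \<in> R)"
    by (rule chord_descent[OF descent arc m])
  then obtain j where n: "5 \<le> n" and j: "(g j, g (j + 2)) \<in> R" by blast
  have fwd: "(g (i + 1), g (i + 3)) \<in> R" if "(g i, g (i + 2)) \<in> R" for i
  proof -
    have "distinct [g (i + 3), g (i + 2), g i, g (i + 1)]"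
      using n by (simp add: g_eq_iff)
    then have "(g (i + 1), g (i + 3)) \<in> R \<or> (g (i + 3), g (i + 1)) \<in> R"
      using adj[of "g (i + 3)" "g (i + 2)" "g i" "g (i + 1)"] that
        step[of i] step[of "i + 2"] by (auto simp add: numeral_eq_Suc)
    then show ?thesis using adjacent_even[of "i + 1" 2] n by (simp add: numeral_eq_Suc)
  qed
  have "(g (j + 2), g (j + 4)) \<in> R"
    using fwd[of "j + 1"] fwd[OF j] by (simp add: numeral_eq_Suc)
  then show False using no_consecutive_short_chords n j by blast
qed

text \<open>Both ends of a chord move inward one step. A chord of span 2 forms a transitive triangle
  with the two arcs that it bypasses.\<close>

lemma anti_quasi_transitive_chordless:
  assumes adj: "\<And>u v w x. distinct [u, v, w, x] \<Longrightarrow> (u, v) \<in> R \<Longrightarrow> (w, v) \<in> R \<Longrightarrow> (w, x) \<in> R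
      \<Longrightarrow> (u, x) \<in> R \<or> (x, u) \<in> R"
    and no_TT3: "\<And>u v w. (u, v) \<in> R \<Longrightarrow> (v, w) \<in> R \<Longrightarrow> (u, w) \<notin> R"
    and arc: "(g i, g (i + m)) \<in> R" and m: "1 < m" "m < n"
  shows False
proof -
  have descent: "\<exists>j. (g j, g (j + m)) \<in> R"
    if "even m" "2 \<le> m" "m + 5 \<le> n" "(g i, g (i + (m + 2))) \<in> R" for i m
  proof -
    have "distinct [g (i + 1 + m), g (i + (m + 2)), g i, g (i + 1)]"
      using that by (simp add: g_eq_iff)
    then have "(g (i + 1), g (i + 1 + m)) \<in> R \<or> (g (i + 1 + m), g (i + 1)) \<in> R"
      using adj[of "g (i + 1 + m)" "g (i + (m + 2))" "g i" "g (i + 1)"] that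
        step[of i] step[of "i + 1 + m"] by auto
    then show ?thesis using adjacent_even[of "i + 1" m] that by (intro exI[of _ "i + 1"]) auto
  qed
  have "5 \<le> n \<and> (\<exists>j. (g j, g (j + 2)) \<in> R)"
    by (rule chord_descent[OF descent arc m])
  then obtain j where "(g j, g (j + 2)) \<in> R" by blast
  then show False using no_TT3[of "g j" "g (j + 1)" "g (j + 2)"] step[of j] step[of "j + 1"] by simp
qed

text \<open>If \<open>n \<ge> 5\<close>, four consecutive vertices form a directed path, and parity
  turns the resulting arc backward, from \<open>g (i + 3)\<close> to \<open>g i\<close>. Such an arc
  followed by a chord and a cycle arc moves both ends of the chord: the tail by three, the head by
  one. A chord of span 2 and a backward arc finally close a directed triangle.\<close>

lemma quasi_transitive_length:
  assumes adj: "\<And>u v w x. distinct [u, v, w, x] \<Longrightarrow> (u, v) \<in> R \<Longrightarrow> (v, w) \<in> R \<Longrightarrow> (w, x) \<in> R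
      \<Longrightarrow> (u, x) \<in> R \<or> (x, u) \<in> R"
  shows "n = 3"
proof (rule ccontr)
  assume "n \<noteq> 3"
  moreover have "n \<noteq> 1" using step[of 0] period[of 0] antisym_arc by fastforce
  ultimately have n: "5 \<le> n" using odd_n by presburger
  have backward: "(g (i + 3), g i) \<in> R" for i
  proof -
    have "distinct [g i, g (i + 1), g (i + 2), g (i + 3)]"
      using n by (simp add: g_eq_iff)
    then have "(g i, g (i + 3)) \<in> R \<or> (g (i + 3), g i) \<in> R"
      using adj[of "g i" "g (i + 1)" "g (i + 2)" "g (i + 3)"]
        step[of i] step[of "i + 1"] step[of "i + 2"] by (simp add: numeral_eq_Suc)
    then show ?thesis using adjacent_odd[of i 3] n by auto
  qed
  have descent: "\<exists>j. (g j, g (j + m)) \<in> R"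
    if "even m" "2 \<le> m" "m + 5 \<le> n" "(g i, g (i + (m + 2))) \<in> R" for i m
  proof -
    have "distinct [g (i + 3), g i, g (i + (m + 2)), g (i + 3 + m)]"
      using that by (simp add: g_eq_iff)
    then have "(g (i + 3), g (i + 3 + m)) \<in> R \<or> (g (i + 3 + m), g (i + 3)) \<in> R"
      using adj[of "g (i + 3)" "g i" "g (i + (m + 2))" "g (i + 3 + m)"] that
        backward[of i] step[of "i + (m + 2)"] by (simp add: numeral_eq_Suc)
    then show ?thesis using adjacent_even[of "i + 3" m] that by (intro exI[of _ "i + 3"]) auto
  qed
  \<comment> \<open>The descent starts from the backward arc into \<open>g 0 = g n\<close>, read as
    a forward chord of span \<open>n - 3\<close>.\<close>
  have "3 + (n - 3) = 0 + n" using n by simp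
  then have long: "(g 3, g (3 + (n - 3))) \<in> R" using backward[of 0] period[of 0] by simp
  have "5 \<le> n \<and> (\<exists>j. (g j, g (j + 2)) \<in> R)"
    by (rule chord_descent[OF descent long]) (use n in auto)
  then obtain j where "(g j, g (j + 2)) \<in> R" by blast
  moreover have "(g (j + 2), g (j + 3)) \<in> R" using step[of "j + 2"] by (simp add: numeral_eq_Suc)
  ultimately have "(g j, g j) \<in> R ^^ Suc (Suc (Suc 0))"
    using backward[of j] by (auto intro!: relpow_Suc_I2)
  then have "n \<le> 3" using minimal[of "Suc (Suc (Suc 0))" "g j"] by simp
  then show False using n by simp
qed

section \<open>From a chordless walk to an induced spanning cycle\<close>

lemma chordless_cycle_on:
  assumes chordless: "\<And>i m. (g i, g (i + m)) \<in> R \<Longrightarrow> 1 < m \<Longrightarrow> m < n \<Longrightarrow> False"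
  shows "cycle_on R (g ` {..<n}) n g"
  unfolding cycle_on_def
proof (intro conjI allI impI)
  have "inj_on g {..<n}"
    by (rule linorder_inj_onI) (use g_neq in auto)
  then show "bij_betw g {..<n} (g ` {..<n})" by (rule inj_on_imp_bij_betw)
next
  fix i j assume i: "i < n" and j: "j < n"
  show "(g i, g j) \<in> R \<longleftrightarrow> j = Suc i mod n"
  proof
    assume "j = Suc i mod n"
    then show "(g i, g j) \<in> R"
      using i step[of i] period[of 0] by (cases "Suc i = n") auto
  next
    assume arc: "(g i, g j) \<in> R"
    then have "i \<noteq> j" using antisym_arc by blast
    then consider "i < j" | "j < i" by linarith
    then show "j = Suc i mod n"
    proof cases
      case 1
      then have "j - i = 1" using chordless[of i "j - i"] arc j by force
      then show ?thesis using 1 j by simp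
    next
      case 2
      \<comment> \<open>An arc to a smaller index is read as ending in the next period. Span 1 then
        leaves only the closing arc from \<open>n - 1\<close> to \<open>0\<close>.\<close>
      then have "g (i + (j + n - i)) = g j" using period[of j] i by simp
      then have "j + n - i = 1" using chordless[of i "j + n - i"] arc 2 i by force
      then have "j = 0" "Suc i = n" using 2 i by simp_all
      then show ?thesis by simp
    qed
  qed
qed

lemma kernel_critical_cycle_on:
  assumes chordless: "\<And>i m. (g i, g (i + m)) \<in> R \<Longrightarrow> 1 < m \<Longrightarrow> m < n \<Longrightarrow> False"
    and crit: "kernel_critical R V" and R: "R \<subseteq> V \<times> V"
  shows "cycle_on R V n g"
proof -
  have cyc: "cycle_on R (g ` {..<n}) n g" using chordless by (rule chordless_cycle_on)
  have "g ` {..<n} \<subseteq> V" using step R by blast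
  moreover have "\<not> g ` {..<n} \<subset> V"
    using crit cycle_on_no_kernel[OF cyc odd_n] unfolding kernel_critical_def by blast
  ultimately show ?thesis using cyc by blast
qed

end

lemma kernel_critical_shortest_odd_closed_walk:
  assumes crit: "kernel_critical R V" and R: "R \<subseteq> V \<times> V" and asym: "asym R"
  obtains n g where "shortest_odd_closed_walk R n g"
proof -
  define P where "P k \<longleftrightarrow> odd k \<and> (\<exists>x. (x, x) \<in> R ^^ k)" for k
  have ex: "\<exists>k. P k" using kernel_critical_odd_closed_walk[OF crit R] by (auto simp: P_def)
  define n where "n = (LEAST k. P k)"
  have "P n" unfolding n_def using ex by (rule LeastI_ex)
  then obtain x where n: "odd n" and "(x, x) \<in> R ^^ n" by (auto simp: P_def)
  then obtain f where f: "f 0 = x" "f n = x" "\<forall>i<n. (f i, f (Suc i)) \<in> R"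
    by (auto simp: relpow_fun_conv)
  have n0: "0 < n" using n by (cases n) auto
  have "shortest_odd_closed_walk R n (\<lambda>i. f (i mod n))"
  proof
    fix i
    have "(f (i mod n), f (Suc (i mod n))) \<in> R" using f n0 by simp
    \<comment> \<open>At the wrap-around the reduced index is \<open>0\<close>, and
      \<open>f 0 = f n\<close>.\<close>
    moreover have "f (Suc i mod n) = f (Suc (i mod n))" using f by (simp add: mod_Suc)
    ultimately show "(f (i mod n), f (Suc i mod n)) \<in> R" by simp
  next
    fix k and y :: 'a assume "odd k" "(y, y) \<in> R ^^ k"
    then show "n \<le> k" unfolding n_def by (intro Least_le) (auto simp: P_def)
  qed (use n asym in simp_all)
  then show ?thesis by (rule that)
qed

section \<open>Translation to digraphs\<close>

lemma has_kernel_iff: "has_kernel D \<longleftrightarrow> (\<exists>S. kernel_on (arcs_ends D) (verts D) S)"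
  unfolding has_kernel_def kernel_of_def kernel_on_def independent_set_def absorbent_set_def by blast

context wf_digraph begin

lemma arcs_ends_subset_verts: "arcs_ends G \<subseteq> verts G \<times> verts G"
  by (auto simp: arcs_ends_conv)

lemma induced_subgraph_arcs_ends:
  assumes "induced_subgraph H G"
  shows "arcs_ends H = arcs_ends G \<inter> verts H \<times> verts H"
proof -
  have "tail H = tail G" "head H = head G"
    using assms by (auto simp: induced_subgraph_def subgraph_def compatible_def)
  then show ?thesis using assms by (auto simp: arcs_ends_conv induced_subgraph_def)
qed

lemma CKI_digraph_iff: "CKI_digraph G \<longleftrightarrow> kernel_critical (arcs_ends G) (verts G)"
proof -
  have H: "has_kernel H \<longleftrightarrow> (\<exists>S. kernel_on (arcs_ends G) (verts H) S)"
    if "induced_subgraph H G" for H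
    unfolding has_kernel_iff induced_subgraph_arcs_ends[OF that]
    by (intro arg_cong[of _ _ Ex] ext) (auto simp: kernel_on_def, blast)
  \<comment> \<open>Every proper vertex subset occurs as the vertex set of an induced subdigraph, so
    both quantifiers range over the same cases.\<close>
  have W: "\<exists>H. induced_subgraph H G \<and> verts H = W" if "W \<subset> verts G" for W
    using that by (intro exI[of _ "G \<restriction> W"]) (auto intro: induced_induce)
  show ?thesis
    unfolding CKI_digraph_def kernel_critical_def has_kernel_iff[of G] using H W by metis
qed

section \<open>Isomorphisms as vertex bijections\<close>

lemma digraph_isoD:
  assumes "digraph_iso G (with_proj P)"
  obtains \<phi> where "bij_betw \<phi> (verts G) (pverts P)"
    "\<And>u v. u \<in> verts G \<Longrightarrow> v \<in> verts G \<Longrightarrow> (u, v) \<in> arcs_ends G \<longleftrightarrow> (\<phi> u, \<phi> v) \<in> parcs P"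
proof -
  obtain f where f: "digraph_isomorphism f" and P: "with_proj P = app_iso f G"
    using assms unfolding digraph_iso_def by blast
  have V: "pverts P = iso_verts f ` verts G" using arg_cong[OF P, of verts] by simp
  have "parcs P = arcs_ends (app_iso f G)" using arg_cong[OF P, of arcs_ends] by simp
  then have A: "parcs P = (\<lambda>e. (iso_verts f (tail G e), iso_verts f (head G e))) ` arcs G"
    using f by (auto simp: arcs_ends_conv iso_verts_tail iso_verts_head image_image)
  have inj: "inj_on (iso_verts f) (verts G)" using f by (simp add: digraph_isomorphism_def)
  show ?thesis
  proof (rule that[of "iso_verts f"])
    show "bij_betw (iso_verts f) (verts G) (pverts P)" using inj V by (simp add: bij_betw_def)
    fix u v assume "u \<in> verts G" "v \<in> verts G"
    then show "(u, v) \<in> arcs_ends G \<longleftrightarrow> (iso_verts f u, iso_verts f v) \<in> parcs P"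
      unfolding A arcs_ends_conv using inj by (auto simp: image_iff inj_on_eq_iff)
  qed
qed

end

text \<open>Without parallel arcs an arc is determined by its ends, so a vertex bijection induces an
  injective map on arcs.\<close>

lemma (in nomulti_digraph) digraph_isoI:
  assumes bij: "bij_betw \<phi> (verts G) (pverts P)"
    and arcs: "\<And>u v. u \<in> verts G \<Longrightarrow> v \<in> verts G \<Longrightarrow> (u, v) \<in> arcs_ends G \<longleftrightarrow> (\<phi> u, \<phi> v) \<in> parcs P"
    and P: "parcs P \<subseteq> pverts P \<times> pverts P"
  shows "digraph_iso G (with_proj P)"
proof -
  \<comment> \<open>Arcs are sent to pairs of vertices, so the new tail and head maps are the
    projections.\<close>
  define f where "f = \<lparr>iso_verts = \<phi>, iso_arcs = (\<lambda>e. (\<phi> (tail G e), \<phi> (head G e))),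
    iso_head = snd, iso_tail = fst\<rparr>"
  have inj: "inj_on \<phi> (verts G)" and V: "pverts P = \<phi> ` verts G"
    using bij by (auto simp: bij_betw_def)
  have "inj_on (iso_arcs f) (arcs G)"
  proof (rule inj_onI)
    fix d e assume "d \<in> arcs G" "e \<in> arcs G" "iso_arcs f d = iso_arcs f e"
    then show "d = e"
      using inj no_multi_arcs[of d e] by (simp add: f_def arc_to_ends_def inj_on_eq_iff)
  qed
  then have "digraph_isomorphism f"
    using inj wf_digraph by (simp add: digraph_isomorphism_def f_def)
  moreover have "with_proj P = app_iso f G"
  proof -
    have "parcs P = (\<lambda>e. (\<phi> (tail G e), \<phi> (head G e))) ` arcs G"
    proof (intro set_eqI iffI)
      fix p assume p: "p \<in> parcs P"
      then obtain u v where uv: "u \<in> verts G" "v \<in> verts G" "p = (\<phi> u, \<phi> v)" using P V by blast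
      then have "(u, v) \<in> arcs_ends G" using arcs p by blast
      then show "p \<in> (\<lambda>e. (\<phi> (tail G e), \<phi> (head G e))) ` arcs G"
        using uv by (auto simp: arcs_ends_conv)
    next
      fix p assume "p \<in> (\<lambda>e. (\<phi> (tail G e), \<phi> (head G e))) ` arcs G"
      then obtain e where "e \<in> arcs G" "p = (\<phi> (tail G e), \<phi> (head G e))" by blast
      then show "p \<in> parcs P"
        using arcs[of "tail G e" "head G e"] by (auto simp: arcs_ends_conv)
    qed
    then show ?thesis using V by (simp add: with_proj_def app_iso_def f_def)
  qed
  ultimately show ?thesis unfolding digraph_iso_def by blast
qed

lemma (in nomulti_digraph) digraph_iso_directed_cycle_iff:
  "digraph_iso G (with_proj (directed_cycle n)) \<longleftrightarrow> (\<exists>v. cycle_on (arcs_ends G) (verts G) n v)"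
proof
  assume "digraph_iso G (with_proj (directed_cycle n))"
  then obtain \<phi> where bij: "bij_betw \<phi> (verts G) (pverts (directed_cycle n))"
    and arcs: "\<And>u v. u \<in> verts G \<Longrightarrow> v \<in> verts G \<Longrightarrow>
      (u, v) \<in> arcs_ends G \<longleftrightarrow> (\<phi> u, \<phi> v) \<in> parcs (directed_cycle n)"
    using digraph_isoD by metis
  let ?v = "the_inv_into (verts G) \<phi>"
  have bij: "bij_betw \<phi> (verts G) {..<n}" using bij by (simp add: directed_cycle_def)
  have v: "bij_betw ?v {..<n} (verts G)" using bij by (rule bij_betw_the_inv_into)
  have "?v i \<in> verts G" "\<phi> (?v i) = i" if "i < n" for i
    using that v bij by (auto simp: bij_betw_apply f_the_inv_into_f_bij_betw)
  then have "cycle_on (arcs_ends G) (verts G) n ?v"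
    using v arcs by (auto simp: cycle_on_def directed_cycle_def)
  then show "\<exists>v. cycle_on (arcs_ends G) (verts G) n v" by blast
next
  assume "\<exists>v. cycle_on (arcs_ends G) (verts G) n v"
  then obtain v where v: "cycle_on (arcs_ends G) (verts G) n v" ..
  then have bij: "bij_betw v {..<n} (verts G)" by (simp add: cycle_on_def)
  have inv: "bij_betw (the_inv_into {..<n} v) (verts G) {..<n}"
    using bij by (rule bij_betw_the_inv_into)
  show "digraph_iso G (with_proj (directed_cycle n))"
  proof (rule digraph_isoI)
    show "bij_betw (the_inv_into {..<n} v) (verts G) (pverts (directed_cycle n))"
      using inv by (simp add: directed_cycle_def)
    show "parcs (directed_cycle n) \<subseteq> pverts (directed_cycle n) \<times> pverts (directed_cycle n)"
      by (auto simp: directed_cycle_def)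
    fix x y assume "x \<in> verts G" "y \<in> verts G"
    then obtain i j where ij: "i < n" "j < n" "x = v i" "y = v j"
      using bij unfolding bij_betw_def by blast
    moreover have "the_inv_into {..<n} v (v k) = k" if "k < n" for k
      using bij that by (simp add: bij_betw_def the_inv_into_f_f)
    ultimately show "(x, y) \<in> arcs_ends G \<longleftrightarrow>
        (the_inv_into {..<n} v x, the_inv_into {..<n} v y) \<in> parcs (directed_cycle n)"
      using v by (auto simp: cycle_on_def directed_cycle_def)
  qed
qed

text \<open>Asymmetry makes the three vertices distinct and excludes reverse arcs, so they would
  induce exactly \<open>TT3\<close>.\<close>

lemma (in digraph) TT3_freeD:
  assumes free: "TT3_free G" and asym: "asym (arcs_ends G)"
    and uv: "(u, v) \<in> arcs_ends G" and vw: "(v, w) \<in> arcs_ends G"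
  shows "(u, w) \<notin> arcs_ends G"
proof
  assume uw: "(u, w) \<in> arcs_ends G"
  let ?H = "G \<restriction> {u, v, w}"
  have no: "(x, y) \<in> arcs_ends G \<Longrightarrow> (y, x) \<notin> arcs_ends G" for x y
    using asym by (auto dest: asymD)
  have dist: "u \<noteq> v" "v \<noteq> w" "u \<noteq> w" using uv vw uw no by blast+
  have "{u, v, w} \<subseteq> verts G" using uv vw arcs_ends_subset_verts by blast
  then have ind: "induced_subgraph ?H G" by (rule induced_induce)
  interpret H: nomulti_digraph ?H
    using digraph_subgraph ind by (metis digraph.axioms(3) induced_subgraph_def)
  \<comment> \<open>The default value \<open>0\<close> serves \<open>u\<close>, the source of the
    triangle.\<close>
  let ?\<phi> = "(\<lambda>_. 0 :: nat)(v := 1, w := 2)"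
  have "digraph_iso ?H (with_proj TT3)"
  proof (rule H.digraph_isoI)
    show "bij_betw ?\<phi> (verts ?H) (pverts TT3)"
      using dist by (auto simp: bij_betw_def inj_on_def TT3_def)
    show "parcs TT3 \<subseteq> pverts TT3 \<times> pverts TT3" by (auto simp: TT3_def)
    fix x y assume "x \<in> verts ?H" "y \<in> verts ?H"
    then show "(x, y) \<in> arcs_ends ?H \<longleftrightarrow> (?\<phi> x, ?\<phi> y) \<in> parcs TT3"
      unfolding induced_subgraph_arcs_ends[OF ind] using dist uv vw uw no
      by (auto simp: TT3_def)
  qed
  then show False using free ind unfolding TT3_free_def by blast
qed

section \<open>The two directions of the characterisation\<close>

lemma (in digraph) odd_cycle_CKI_digraph:
  assumes "digraph_iso G (with_proj (directed_cycle n))" "odd n"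
  shows "CKI_digraph G"
  using assms cycle_on_kernel_critical
  unfolding CKI_digraph_iff digraph_iso_directed_cycle_iff by blast

lemma (in digraph) triangle_three_quasi_transitive:
  assumes "digraph_iso G (with_proj (directed_cycle 3))"
  shows "asymmetric G" "three_quasi_transitive G"
proof -
  obtain v where v: "cycle_on (arcs_ends G) (verts G) 3 v"
    using assms digraph_iso_directed_cycle_iff by blast
  then have V: "verts G = v ` {..<3}" by (simp add: cycle_on_def bij_betw_def)
  show "asymmetric G"
    unfolding asymmetric_def
  proof (rule asymI)
    fix x y assume xy: "(x, y) \<in> arcs_ends G"
    then obtain i j where ij: "i < 3" "j < 3" "x = v i" "y = v j"
      using V arcs_ends_subset_verts by blast
    then have "j = Suc i mod 3" using v xy by (simp add: cycle_on_def)
    \<comment> \<open>Two steps around a triangle do not return to the start.\<close>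
    then have "i \<noteq> Suc j mod 3" using ij by presburger
    then show "(y, x) \<notin> arcs_ends G" using ij v by (simp add: cycle_on_def)
  qed
  have card: "card (verts G) \<le> 3" unfolding V using card_image_le[of "{..<3::nat}" v] by simp
  show "three_quasi_transitive G"
    unfolding three_quasi_transitive_def
  proof (intro allI impI)
    fix a b c d
    assume *: "distinct [a, b, c, d] \<and> a \<rightarrow>\<^bsub>G\<^esub> b \<and> b \<rightarrow>\<^bsub>G\<^esub> c \<and> c \<rightarrow>\<^bsub>G\<^esub> d"
    \<comment> \<open>The condition holds vacuously: four distinct vertices do not fit into
      three.\<close>
    then have "set [a, b, c, d] \<subseteq> verts G" using arcs_ends_subset_verts by auto
    then have "card (set [a, b, c, d]) \<le> 3" using card card_mono[OF finite_verts] le_trans by blast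
    then show "adjacent G a d" using * distinct_card[of "[a, b, c, d]"] by simp
  qed
qed

lemma (in digraph) CKI_three_quasi_transitive:
  assumes asym: "asymmetric G" and qt: "three_quasi_transitive G" and cki: "CKI_digraph G"
  shows "digraph_iso G (with_proj (directed_cycle 3))"
proof -
  have crit: "kernel_critical (arcs_ends G) (verts G)" using cki by (simp add: CKI_digraph_iff)
  obtain n g where ng: "shortest_odd_closed_walk (arcs_ends G) n g"
    using kernel_critical_shortest_odd_closed_walk[OF crit arcs_ends_subset_verts] asym
    unfolding asymmetric_def by blast
  interpret C: shortest_odd_closed_walk "arcs_ends G" n g by (rule ng)
  have n: "n = 3"
    using C.quasi_transitive_length qt unfolding three_quasi_transitive_def adjacent_def by blast
  \<comment> \<open>A chord needs span at least 2 and \<open>m + 3 \<le> n\<close>, impossible for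
    \<open>n = 3\<close>.\<close>
  have "cycle_on (arcs_ends G) (verts G) n g"
    using C.chord(2) n by (intro C.kernel_critical_cycle_on[OF _ crit arcs_ends_subset_verts]) fastforce
  then show ?thesis unfolding digraph_iso_directed_cycle_iff n by blast
qed

lemma (in digraph) CKI_directed_odd_cycle:
  assumes asym: "asymmetric G" and cki: "CKI_digraph G"
    and cls: "arc_locally_in_semicomplete G \<or> arc_locally_out_semicomplete G \<or>
      three_anti_quasi_transitive G \<and> TT3_free G"
  shows "\<exists>n. odd n \<and> is_directed_cycle G n"
proof -
  have crit: "kernel_critical (arcs_ends G) (verts G)" using cki by (simp add: CKI_digraph_iff)
  obtain n g where ng: "shortest_odd_closed_walk (arcs_ends G) n g"
    using kernel_critical_shortest_odd_closed_walk[OF crit arcs_ends_subset_verts] asym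
    unfolding asymmetric_def by blast
  interpret C: shortest_odd_closed_walk "arcs_ends G" n g by (rule ng)
  have chordless: False if arc: "(g i, g (i + m)) \<in> arcs_ends G" and m: "1 < m" "m < n" for i m
    using cls
  proof (elim disjE conjE)
    assume "arc_locally_in_semicomplete G"
    then show False
      unfolding arc_locally_in_semicomplete_def adjacent_def
      by (intro C.in_semicomplete_chordless[OF _ arc m]) blast
  next
    assume "arc_locally_out_semicomplete G"
    then show False
      unfolding arc_locally_out_semicomplete_def adjacent_def
      by (intro C.out_semicomplete_chordless[OF _ arc m]) blast
  next
    assume "three_anti_quasi_transitive G" "TT3_free G"
    then show False
      unfolding three_anti_quasi_transitive_def adjacent_def
      by (intro C.anti_quasi_transitive_chordless[OF _ TT3_freeD arc m])
        (use asym in \<open>auto simp: asymmetric_def\<close>)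
  qed
  have "cycle_on (arcs_ends G) (verts G) n g"
    by (rule C.kernel_critical_cycle_on[OF chordless crit arcs_ends_subset_verts])
  then have "digraph_iso G (with_proj (directed_cycle n))"
    unfolding digraph_iso_directed_cycle_iff by blast
  \<comment> \<open>Length 1 would be a loop, which asymmetry forbids.\<close>
  moreover have "n \<noteq> 1" using C.step[of 0] C.period[of 0] C.antisym_arc by fastforce
  then have "2 \<le> n" using C.odd_n by presburger
  ultimately show ?thesis using C.odd_n unfolding is_directed_cycle_def by blast
qed

theorem theorem11:
  fixes D :: "('a, 'b) pre_digraph"
  assumes "digraph D"
  shows "(asymmetric D \<and> three_quasi_transitive D \<and> CKI_digraph D \<longleftrightarrow>
            digraph_iso D (with_proj (directed_cycle 3))) \<and>
         (asymmetric D \<and>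
            (arc_locally_in_semicomplete D \<or> arc_locally_out_semicomplete D \<or>
             three_anti_quasi_transitive D \<and> TT3_free D) \<longrightarrow>
            (CKI_digraph D \<longleftrightarrow> (\<exists>n. odd n \<and> is_directed_cycle D n)))"
proof -
  interpret digraph D by (rule assms)
  have "odd (3 :: nat)" by simp
  then show ?thesis
    using CKI_three_quasi_transitive triangle_three_quasi_transitive CKI_directed_odd_cycle
      odd_cycle_CKI_digraph unfolding is_directed_cycle_def by blast
qed

end
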